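(* Let $\mathcal{P}\subset\mathbb{R}^n$ be an (open) convex polytope, and let $d_{\mathcal{P}}$ be its Hilbert distance. Then the Hilbert geometry $(\mathcal{P},d_{\mathcal{P}})$ is bi-Lipschitz to the $n$-dimensional Euclidean geometry $(\mathbb{R}^n,\Vert\cdot\Vert)$. In other words, there exist a map $F\colon\mathcal{P}\to\mathbb{R}^n$ and a constant $L$ such that for any two points $x$ and $y$ in $\mathcal{P}$, $$\frac{1}{L}\cdot\bigl\Vert F(x)-F(y)\bigr\Vert\leq d_{\mathcal{P}}(x,y)\leq L\cdot\bigl\Vert F(x)-F(y)\bigr\Vert .$$
   Context: A convex domain is a non-empty bounded open convex set $\mathcal{C}\subset\mathbb{R}^n$. Its Hilbert distance $d_{\mathcal{C}}$ is defined by $d_{\mathcal{C}}(p,p)=0$ and, for distinct points $p,q\in\mathcal{C}$, as follows: the line through $p$ and $q$ meets the boundary $\partial\mathcal{C}$ at two points $a,b$, named so that $a,p,q,b$ occur in this order on the line, and $$d_{\mathcal{C}}(p,q)=\frac12\ln[a,p,q,b],\qquad [a,p,q,b]=\frac{\|q-a\|}{\|p-a\|}\cdot\frac{\|p-b\|}{\|q-b\|},$$ where $\|\cdot\|$ is the canonical Euclidean norm on $\mathbb{R}^n$. The pair $(\mathcal{C},d_{\mathcal{C}})$ is called the Hilbert geometry of $\mathcal{C}$. A convex polytope, as a convex domain, is the interior (assumed non-empty) of the convex hull of finitely many points of $\mathbb{R}^n$. *)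

theory Defs
  imports "HOL-Analysis.Analysis"
begin

definition open_convex_polytope :: "'a::euclidean_space set \<Rightarrow> bool" where
  "open_convex_polytope P \<longleftrightarrow> P \<noteq> {} \<and> (\<exists>K. polytope K \<and> P = interior K)"

definition cross_ratio :: "'a::euclidean_space \<Rightarrow> 'a \<Rightarrow> 'a \<Rightarrow> 'a \<Rightarrow> real" where
  "cross_ratio a p q b = (norm (q - a) / norm (p - a)) * (norm (p - b) / norm (q - b))"

text \<open>The line through \<open>p\<close> and \<open>q\<close> meets the boundary of \<open>C\<close> in exactly the two points
  \<open>a\<close> and \<open>b\<close>, and \<open>a, p, q, b\<close> are pairwise distinct and occur in this order on the line.\<close>

definition hilbert_ends ::
    "'a::euclidean_space set \<Rightarrow> 'a \<Rightarrow> 'a \<Rightarrow> 'a \<Rightarrow> 'a \<Rightarrow> bool" where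
  "hilbert_ends C p q a b \<longleftrightarrow>
     affine hull {p, q} \<inter> frontier C = {a, b} \<and>
     p \<in> open_segment a q \<and> q \<in> open_segment p b"

text \<open>For distinct points of a bounded open convex set the end points exist and are unique,
  so the description below denotes the intended number; outside that situation the value
  is of no significance.\<close>

definition hilbert_dist :: "'a::euclidean_space set \<Rightarrow> 'a \<Rightarrow> 'a \<Rightarrow> real" where
  "hilbert_dist C p q =
     (if p = q then 0
      else (THE d. \<exists>a b. hilbert_ends C p q a b \<and> d = 1 / 2 * ln (cross_ratio a p q b)))"

end

theory Submission
  imports Defs
begin

text \<open>Write the polytope as \<open>P = {x. \<forall>h\<in>H. slack h x > 0}\<close> with finitely many affine
  functions \<open>slack h\<close>, whose gradients are the inward normals \<open>fst h\<close> of the half-spaces. Two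
  facts make the theorem true.

  First, an end point of a chord is the place where a slack first vanishes, so the two ratios in the
  cross ratio are the largest values of \<open>slack h q / slack h p\<close> and of \<open>slack h p / slack h q\<close>
  (lemma \<open>hilbert_dist_cell\<close>). Hence, up to a factor depending only on the number of half-spaces, the
  Hilbert distance of \<open>p\<close> and \<open>q\<close> is the \<open>l\<^sup>1\<close> distance \<open>log_gap H p q\<close> between the vectors
  of logarithms of the slacks.

  Second, the map \<open>F x = (\<Sum>h\<in>H. ln (slack h x) *\<^sub>R fst h)\<close>, the gradient of the convex function
  \<open>\<Sum>h\<in>H. slack h x * ln (slack h x) - slack h x\<close>, is bi-Lipschitz for \<open>log_gap H\<close>. The upper
  bound is the triangle inequality. For the lower bound, observe that the coefficients
  \<open>z h = ln (slack h x) - ln (slack h y)\<close> of \<open>F x - F y\<close> have the same signs as the numbers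
  \<open>fst h \<bullet> (x - y)\<close>. If \<open>v\<close> is any vector for which the \<open>fst h \<bullet> v\<close> have these signs too,
  then in \<open>(F x - F y) \<bullet> v = (\<Sum>h\<in>H. z h * (fst h \<bullet> v))\<close> nothing cancels, so every \<open>\<bar>z h\<bar>\<close> is
  bounded by a multiple of \<open>norm (F x - F y)\<close> that depends on \<open>v\<close> alone. Only finitely many
  sign patterns occur, so finitely many \<open>v\<close> suffice and the constant is uniform (lemma
  \<open>sign_coherent_sum_bound\<close>).

  The lower bound makes \<open>F\<close> injective and keeps points with bounded image away from the boundary.
  So the image of \<open>F\<close> is open, by invariance of domain, and closed, by compactness, hence it is
  the whole space.\<close>

section \<open>Polytopes as intersections of open half-spaces\<close>

definition slack :: "'a::euclidean_space \<times> real \<Rightarrow> 'a \<Rightarrow> real" where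
  "slack h x = fst h \<bullet> x - snd h"

definition cell :: "('a::euclidean_space \<times> real) set \<Rightarrow> 'a set" where
  "cell H = {x. \<forall>h\<in>H. 0 < slack h x}"

lemma continuous_on_slack [continuous_intros]: "continuous_on S (slack h)"
  unfolding slack_def by (intro continuous_intros)

lemma slack_convex_combination:
  "slack h ((1 - s) *\<^sub>R a + s *\<^sub>R q) = (1 - s) * slack h a + s * slack h q"
  by (simp add: slack_def algebra_simps)

lemma open_cell:
  assumes "finite H"
  shows "open (cell H)"
proof -
  have "cell H = (\<Inter>h\<in>H. {x. 0 < slack h x})"
    by (auto simp: cell_def)
  moreover have "open {x. 0 < slack h x}" for h :: "'a \<times> real"
    by (intro open_Collect_less continuous_intros)
  ultimately show ?thesis
    using assms by auto
qed

lemma convex_cell: "convex (cell H)"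
proof -
  have "cell H = (\<Inter>h\<in>H. {x. fst h \<bullet> x > snd h})"
    by (auto simp: cell_def slack_def)
  then show ?thesis
    by (simp add: convex_INT convex_halfspace_gt)
qed

lemma frontier_cell:
  assumes "finite H" "a \<in> frontier (cell H)"
  shows "\<And>h. h \<in> H \<Longrightarrow> 0 \<le> slack h a" and "\<exists>h\<in>H. slack h a = 0"
proof -
  have cl: "a \<in> closure (cell H)" and "a \<notin> cell H"
    using assms open_cell[OF assms(1)] by (auto simp: frontier_def interior_open)
  show nonneg: "0 \<le> slack h a" if "h \<in> H" for h
  proof -
    have "closed {x. 0 \<le> slack h x}"
      by (intro closed_Collect_le continuous_intros)
    moreover have "cell H \<subseteq> {x. 0 \<le> slack h x}"
      using that by (auto simp: cell_def less_imp_le)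
    ultimately show ?thesis
      using cl closure_minimal by blast
  qed
  show "\<exists>h\<in>H. slack h a = 0"
    using \<open>a \<notin> cell H\<close> nonneg by (force simp: cell_def)
qed

lemma open_convex_polytope_cell:
  assumes "open_convex_polytope P"
  obtains H where "finite H" "P = cell H" "bounded P" "P \<noteq> {}"
proof -
  obtain K where K: "polytope K" "P = interior K" and "P \<noteq> {}"
    using assms by (auto simp: open_convex_polytope_def)
  have "bounded P"
    using K polytope_imp_bounded bounded_subset interior_subset by metis
  obtain G where G: "finite G" "K = \<Inter>G"
    and "\<forall>S\<in>G. \<exists>a b. a \<noteq> 0 \<and> S = {x. a \<bullet> x \<le> b}"
    using polytope_imp_polyhedron[OF K(1)] unfolding polyhedron_def by blast
  then obtain a b where ab: "\<And>S. S \<in> G \<Longrightarrow> a S \<noteq> 0 \<and> S = {x. a S \<bullet> x \<le> b S}"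
    by metis
  define H where "H = (\<lambda>S. (- a S, - b S)) ` G"
  have "finite H"
    using G by (simp add: H_def)
  have cell: "cell H = {x. \<forall>S\<in>G. a S \<bullet> x < b S}"
    by (auto simp: cell_def H_def slack_def)
  have "interior K \<subseteq> cell H"
  proof
    fix x assume x: "x \<in> interior K"
    have "a S \<bullet> x < b S" if "S \<in> G" for S
    proof -
      have "K \<subseteq> S"
        using that G by auto
      then have "x \<in> interior S"
        using x interior_mono by blast
      moreover have "interior S = {x. a S \<bullet> x < b S}"
        using ab[OF that] interior_halfspace_le[of "a S" "b S"] by simp
      ultimately show ?thesis
        by simp
    qed
    then show "x \<in> cell H"
      by (simp add: cell)
  qed
  moreover have "cell H \<subseteq> K"
  proof
    fix x assume x: "x \<in> cell H"
    have "x \<in> S" if "S \<in> G" for S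
    proof -
      have "x \<in> {x. a S \<bullet> x \<le> b S}"
        using x that by (auto simp: cell less_imp_le)
      then show ?thesis
        using ab[OF that] by simp
    qed
    then show "x \<in> K"
      using G by auto
  qed
  ultimately have "P = cell H"
    using K(2) interior_maximal[OF _ open_cell[OF \<open>finite H\<close>]] by blast
  then show thesis
    using that \<open>finite H\<close> \<open>bounded P\<close> \<open>P \<noteq> {}\<close> by blast
qed

section \<open>The Hilbert distance in terms of slacks\<close>

text \<open>Past its first frontier point a ray from the open convex set \<open>C\<close> has left the closure of \<open>C\<close>:
  otherwise that frontier point would lie between a point of \<open>C\<close> and a point of the closure, and so in
  the interior.\<close>

lemma ray_meets_frontier_once:
  fixes C :: "'a::euclidean_space set"
  assumes "open C" "convex C" "bounded C" "p \<in> C" "l \<noteq> 0"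
  obtains d where "0 < d" "p + d *\<^sub>R l \<in> frontier C"
    "\<And>t. 0 \<le> t \<Longrightarrow> p + t *\<^sub>R l \<in> frontier C \<Longrightarrow> t = d"
proof -
  obtain d where d: "0 < d" "p + d *\<^sub>R l \<in> frontier C"
    and inside: "\<And>e. 0 \<le> e \<Longrightarrow> e < d \<Longrightarrow> p + e *\<^sub>R l \<in> interior C"
    using ray_to_frontier[of C p l] assms by (auto simp: interior_open)
  have "t = d" if t: "0 \<le> t" "p + t *\<^sub>R l \<in> frontier C" for t
  proof (rule ccontr)
    assume "t \<noteq> d"
    moreover have "\<not> t < d"
      using inside[of t] t by (auto simp: frontier_def)
    ultimately have "d < t"
      by simp
    have "p + d *\<^sub>R l = (1 - d / t) *\<^sub>R p + (d / t) *\<^sub>R (p + t *\<^sub>R l)"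
      using \<open>d < t\<close> d(1) by (simp add: algebra_simps)
    moreover have "0 < d / t" "d / t < 1" "p \<noteq> p + t *\<^sub>R l"
      using \<open>d < t\<close> d(1) \<open>l \<noteq> 0\<close> by auto
    ultimately have "p + d *\<^sub>R l \<in> open_segment p (p + t *\<^sub>R l)"
      unfolding in_segment by blast
    moreover have "open_segment p (p + t *\<^sub>R l) \<subseteq> interior C"
      using assms t by (intro in_interior_closure_convex_segment) (auto simp: interior_open frontier_def)
    ultimately show False
      using d(2) by (auto simp: frontier_def)
  qed
  then show thesis
    using that d by blast
qed

lemma hilbert_ends_exist:
  fixes C :: "'a::euclidean_space set"
  assumes C: "open C" "convex C" "bounded C" and pq: "p \<in> C" "q \<in> C" "p \<noteq> q"
  obtains a b where "hilbert_ends C p q a b"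
proof -
  define l where "l = q - p"
  have "l \<noteq> 0"
    using pq by (simp add: l_def)
  obtain d where d: "0 < d" "p + d *\<^sub>R l \<in> frontier C"
    and d_only: "\<And>t. 0 \<le> t \<Longrightarrow> p + t *\<^sub>R l \<in> frontier C \<Longrightarrow> t = d"
    using ray_meets_frontier_once[OF C pq(1) \<open>l \<noteq> 0\<close>] by blast
  obtain e where e: "0 < e" "q + e *\<^sub>R (- l) \<in> frontier C"
    and e_only: "\<And>t. 0 \<le> t \<Longrightarrow> q + t *\<^sub>R (- l) \<in> frontier C \<Longrightarrow> t = e"
    using ray_meets_frontier_once[OF C pq(2), of "- l"] \<open>l \<noteq> 0\<close> by auto
  have seg: "p + t *\<^sub>R l \<notin> frontier C" if "0 \<le> t" "t \<le> 1" for t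
  proof -
    have "p + t *\<^sub>R l = (1 - t) *\<^sub>R p + t *\<^sub>R q"
      by (simp add: l_def algebra_simps)
    then have "p + t *\<^sub>R l \<in> C"
      using convexD_alt[OF C(2) pq(1,2) that] by simp
    then show ?thesis
      using C(1) by (auto simp: frontier_def interior_open)
  qed
  have reversed: "q + t *\<^sub>R (- l) = p + (1 - t) *\<^sub>R l" for t
    by (simp add: l_def algebra_simps)
  define a b where "a = p + (1 - e) *\<^sub>R l" and "b = p + d *\<^sub>R l"
  have "1 < d"
    using seg[of d] d by force
  have "1 < e"
  proof (rule ccontr)
    assume "\<not> 1 < e"
    moreover have "p + (1 - e) *\<^sub>R l \<in> frontier C"
      using e(2) by (simp only: reversed)
    ultimately show False
      using seg[of "1 - e"] e(1) by simp
  qed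
  have "affine hull {p, q} \<inter> frontier C = {a, b}"
  proof (intro equalityI subsetI)
    fix z assume z: "z \<in> affine hull {p, q} \<inter> frontier C"
    then obtain t where t: "z = p + t *\<^sub>R l"
      by (auto simp: affine_hull_2_alt l_def)
    show "z \<in> {a, b}"
    proof (cases "0 \<le> t")
      case True
      then show ?thesis
        using d_only z t by (auto simp: b_def)
    next
      case False
      have "z = q + (1 - t) *\<^sub>R (- l)"
        using reversed[of "1 - t"] t by simp
      then have "1 - t = e"
        using e_only[of "1 - t"] z False by auto
      then show ?thesis
        using t by (auto simp: a_def)
    qed
  next
    fix z assume "z \<in> {a, b}"
    then show "z \<in> affine hull {p, q} \<inter> frontier C"
      using d(2) e(2) reversed[of e] by (auto simp: a_def b_def affine_hull_2_alt l_def)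
  qed
  moreover have "p \<in> open_segment a q"
  proof -
    have "p = (1 - (e - 1) / e) *\<^sub>R a + ((e - 1) / e) *\<^sub>R q"
    proof -
      have "q - a = e *\<^sub>R l"
        by (simp add: a_def l_def algebra_simps)
      have "(1 - (e - 1) / e) *\<^sub>R a + ((e - 1) / e) *\<^sub>R q = a + ((e - 1) / e) *\<^sub>R (q - a)"
        by (simp add: algebra_simps)
      also have "\<dots> = a + (e - 1) *\<^sub>R l"
        using \<open>1 < e\<close> by (simp add: \<open>q - a = e *\<^sub>R l\<close>)
      also have "\<dots> = p"
        by (simp add: a_def algebra_simps)
      finally show ?thesis
        by simp
    qed
    moreover have "0 < (e - 1) / e" "(e - 1) / e < 1"
      using \<open>1 < e\<close> by (auto simp: field_simps)
    moreover have "a \<noteq> q"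
      using e(1) \<open>l \<noteq> 0\<close> by (simp add: a_def flip: reversed)
    ultimately show ?thesis
      unfolding in_segment by blast
  qed
  moreover have "q \<in> open_segment p b"
  proof -
    have "q = (1 - 1 / d) *\<^sub>R p + (1 / d) *\<^sub>R b"
      using \<open>1 < d\<close> by (simp add: b_def l_def algebra_simps)
    moreover have "0 < 1 / d" "1 / d < 1" "p \<noteq> b"
      using \<open>1 < d\<close> \<open>l \<noteq> 0\<close> by (auto simp: b_def)
    ultimately show ?thesis
      unfolding in_segment by blast
  qed
  ultimately show thesis
    using that by (auto simp: hilbert_ends_def)
qed

text \<open>This is the reverse Funk weak metric of the cell, of which the Hilbert distance is the
  symmetrization.\<close>

definition max_log_ratio :: "('a::euclidean_space \<times> real) set \<Rightarrow> 'a \<Rightarrow> 'a \<Rightarrow> real" where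
  "max_log_ratio H p q = Max ((\<lambda>h. ln (slack h q) - ln (slack h p)) ` H)"

text \<open>With \<open>p = (1 - s) *\<^sub>R a + s *\<^sub>R q\<close>, the distance ratio is \<open>1 / s\<close>. Since the slacks are affine
  and non-negative at \<open>a\<close>, each ratio \<open>slack h q / slack h p\<close> is at most \<open>1 / s\<close>, with equality for those \<open>h\<close>
  whose slack vanishes at \<open>a\<close>.\<close>

lemma ln_end_point_ratio:
  assumes H: "finite H" and pq: "p \<in> cell H" "q \<in> cell H"
    and a: "a \<in> frontier (cell H)" "p \<in> open_segment a q"
  shows "ln (norm (q - a) / norm (p - a)) = max_log_ratio H p q" and "0 < max_log_ratio H p q"
    and "1 < norm (q - a) / norm (p - a)"
proof -
  obtain s where s: "0 < s" "s < 1" and p: "p = (1 - s) *\<^sub>R a + s *\<^sub>R q" and "a \<noteq> q"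
    using a(2) unfolding in_segment by blast
  have "p - a = s *\<^sub>R (q - a)"
    by (simp add: p algebra_simps)
  then have ratio: "norm (q - a) / norm (p - a) = 1 / s"
    using s \<open>a \<noteq> q\<close> by simp
  have slack_p: "slack h p = (1 - s) * slack h a + s * slack h q" for h
    by (simp add: p slack_convex_combination)
  have pos: "0 < slack h p" "0 < slack h q" if "h \<in> H" for h
    using that pq by (auto simp: cell_def)
  have "ln (slack h q) - ln (slack h p) \<le> ln (1 / s)" if "h \<in> H" for h
  proof -
    have "s * slack h q \<le> slack h p"
      using frontier_cell(1)[OF H a(1) that] s by (simp add: slack_p)
    then have "ln (s * slack h q) \<le> ln (slack h p)"
      using pos[OF that] s by simp
    then show ?thesis
      using pos[OF that] s by (simp add: ln_mult ln_div)
  qed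
  moreover obtain k where k: "k \<in> H" "slack k a = 0"
    using frontier_cell(2)[OF H a(1)] by blast
  moreover have "ln (slack k q) - ln (slack k p) = ln (1 / s)"
    using pos[OF k(1)] s k(2) by (simp add: slack_p ln_mult ln_div)
  ultimately have "max_log_ratio H p q = ln (1 / s)"
    unfolding max_log_ratio_def using H by (intro Max_eqI) (auto intro: rev_image_eqI)
  then show "ln (norm (q - a) / norm (p - a)) = max_log_ratio H p q" "0 < max_log_ratio H p q"
    "1 < norm (q - a) / norm (p - a)"
    using s ratio by (auto simp: ln_div)
qed

lemma hilbert_dist_cell:
  assumes H: "finite H" and "bounded (cell H)" and pq: "p \<in> cell H" "q \<in> cell H" "p \<noteq> q"
  shows "hilbert_dist (cell H) p q = (max_log_ratio H p q + max_log_ratio H q p) / 2"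
    and "0 < max_log_ratio H p q" and "0 < max_log_ratio H q p"
proof -
  have chord: "1 / 2 * ln (cross_ratio a p q b) = (max_log_ratio H p q + max_log_ratio H q p) / 2
      \<and> 0 < max_log_ratio H p q \<and> 0 < max_log_ratio H q p"
    if "hilbert_ends (cell H) p q a b" for a b
  proof -
    have ab: "a \<in> frontier (cell H)" "b \<in> frontier (cell H)"
      "p \<in> open_segment a q" "q \<in> open_segment b p"
      using that by (auto simp: hilbert_ends_def open_segment_commute)
    note A = ln_end_point_ratio[OF H pq(1,2) ab(1,3)]
    note B = ln_end_point_ratio[OF H pq(2,1) ab(2,4)]
    have "ln (cross_ratio a p q b)
        = ln (norm (q - a) / norm (p - a)) + ln (norm (p - b) / norm (q - b))"
      unfolding cross_ratio_def using A(3) B(3) by (intro ln_mult_pos) linarith+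
    then show ?thesis
      using A B by simp
  qed
  obtain a b where ab: "hilbert_ends (cell H) p q a b"
    using hilbert_ends_exist[OF open_cell[OF H] convex_cell assms(2) pq] by blast
  show "0 < max_log_ratio H p q" "0 < max_log_ratio H q p"
    using chord[OF ab] by auto
  show "hilbert_dist (cell H) p q = (max_log_ratio H p q + max_log_ratio H q p) / 2"
  proof -
    have "(THE d. \<exists>a b. hilbert_ends (cell H) p q a b \<and> d = 1 / 2 * ln (cross_ratio a p q b))
        = (max_log_ratio H p q + max_log_ratio H q p) / 2"
    proof (rule the_equality)
      show "\<exists>a b. hilbert_ends (cell H) p q a b
          \<and> (max_log_ratio H p q + max_log_ratio H q p) / 2 = 1 / 2 * ln (cross_ratio a p q b)"
        using ab chord[OF ab] by force
    qed (use chord in blast)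
    then show ?thesis
      using pq(3) by (simp add: hilbert_dist_def)
  qed
qed

definition log_gap :: "('a::euclidean_space \<times> real) set \<Rightarrow> 'a \<Rightarrow> 'a \<Rightarrow> real" where
  "log_gap H x y = (\<Sum>h\<in>H. \<bar>ln (slack h x) - ln (slack h y)\<bar>)"

lemma log_gap_commute: "log_gap H x y = log_gap H y x"
  by (simp add: log_gap_def abs_minus_commute)

lemma log_gap_member:
  assumes "finite H" "h \<in> H"
  shows "\<bar>ln (slack h x) - ln (slack h y)\<bar> \<le> log_gap H x y"
  unfolding log_gap_def using assms by (intro member_le_sum) auto

lemma max_log_ratio_le_log_gap:
  assumes "finite H" "H \<noteq> {}"
  shows "max_log_ratio H x y \<le> log_gap H x y"
  unfolding max_log_ratio_def
proof (rule Max.boundedI)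
  fix r assume "r \<in> (\<lambda>h. ln (slack h y) - ln (slack h x)) ` H"
  then obtain h where "h \<in> H" "r = ln (slack h y) - ln (slack h x)"
    by blast
  then show "r \<le> log_gap H x y"
    using log_gap_member[OF assms(1), of h x y] by linarith
qed (use assms in auto)

text \<open>Both maxima are positive, so the larger one, which is the largest \<open>\<bar>ln (slack h x) - ln (slack h y)\<bar>\<close>,
  is controlled by their sum.\<close>

lemma log_gap_equivalent_hilbert_dist:
  assumes H: "finite H" and "bounded (cell H)" and xy: "x \<in> cell H" "y \<in> cell H"
  shows "hilbert_dist (cell H) x y \<le> log_gap H x y"
    and "log_gap H x y \<le> 2 * card H * hilbert_dist (cell H) x y"
    and "x \<noteq> y \<Longrightarrow> 0 < hilbert_dist (cell H) x y"
proof -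
  have "hilbert_dist (cell H) x y \<le> log_gap H x y
      \<and> log_gap H x y \<le> 2 * card H * hilbert_dist (cell H) x y
      \<and> 0 < hilbert_dist (cell H) x y" if "x \<noteq> y"
  proof -
    note d = hilbert_dist_cell[OF assms that]
    have "H \<noteq> {}"
      using hilbert_dist_cell(2)[OF assms that] assms(2) by (auto simp: cell_def)
    have "max_log_ratio H x y \<le> log_gap H x y" "max_log_ratio H y x \<le> log_gap H x y"
      using max_log_ratio_le_log_gap[OF H \<open>H \<noteq> {}\<close>] log_gap_commute[of H x y] by metis+
    moreover have "log_gap H x y \<le> card H * (2 * hilbert_dist (cell H) x y)"
      unfolding log_gap_def
    proof (rule sum_bounded_above)
      fix h assume "h \<in> H"
      then have "ln (slack h y) - ln (slack h x) \<le> max_log_ratio H x y"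
        "ln (slack h x) - ln (slack h y) \<le> max_log_ratio H y x"
        unfolding max_log_ratio_def using H by (auto intro!: Max_ge)
      then show "\<bar>ln (slack h x) - ln (slack h y)\<bar> \<le> 2 * hilbert_dist (cell H) x y"
        using d by (simp add: abs_le_iff)
    qed
    ultimately show ?thesis
      using d(2,3) unfolding d(1) by (simp add: mult.commute mult.left_commute field_simps)
  qed
  moreover have "hilbert_dist (cell H) x x = 0" "log_gap H x x = 0"
    by (auto simp: hilbert_dist_def log_gap_def)
  ultimately show "hilbert_dist (cell H) x y \<le> log_gap H x y"
    "log_gap H x y \<le> 2 * card H * hilbert_dist (cell H) x y"
    "x \<noteq> y \<Longrightarrow> 0 < hilbert_dist (cell H) x y"
    by (cases "x = y"; auto)+
qed

section \<open>Sign-coherent linear combinations\<close>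

text \<open>When \<open>z h\<close> has the sign of \<open>a h \<bullet> v\<close> for every \<open>h\<close>, the inner product of \<open>\<Sum>h\<in>I. z h *\<^sub>R a h\<close>
  with \<open>v\<close> is the sum of the non-negative numbers \<open>\<bar>z h\<bar> * \<bar>a h \<bullet> v\<bar>\<close>. This bounds each \<open>\<bar>z h\<bar>\<close>, but the
  constant degenerates as some \<open>a h \<bullet> v\<close> tends to \<open>0\<close>. The same estimate with a fixed representative of
  the sign pattern of \<open>v\<close> in place of \<open>v\<close> repairs this. Applied with \<open>z h = w h * (a h \<bullet> v)\<close> for
  positive weights \<open>w\<close>, the lemma is the uniform boundedness of weighted pseudo-inverses due to Stewart
  and Todd.\<close>

lemma sign_coherent_sum_bound:
  fixes a :: "'i \<Rightarrow> 'a::euclidean_space"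
  assumes "finite I"
  obtains C where "0 < C"
    "\<And>v z. (\<And>h. h \<in> I \<Longrightarrow> sgn (z h) = sgn (a h \<bullet> v)) \<Longrightarrow>
       (\<Sum>h\<in>I. \<bar>z h\<bar>) \<le> C * norm (\<Sum>h\<in>I. z h *\<^sub>R a h)"
proof -
  define pat where "pat v = (\<lambda>h. if h \<in> I then sgn (a h \<bullet> v) else 0)" for v
  have "range pat \<subseteq> {f. \<forall>h. (h \<in> I \<longrightarrow> f h \<in> {- 1, 0, 1}) \<and> (h \<notin> I \<longrightarrow> f h = 0)}"
    using sgn_real_def by (force simp: pat_def)
  then have "finite (range pat)"
    using finite_subset finite_set_of_finite_funs[OF assms, of "{- 1, 0, 1::real}" 0] by blast
  then obtain V where V: "finite V" "range pat = pat ` V"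
    using finite_subset_image[of "range pat" pat UNIV] by auto
  define K where "K v = (\<Sum>h\<in>I. norm v / \<bar>a h \<bullet> v\<bar>)" for v
  have K_nonneg: "0 \<le> K v" for v
    by (simp add: K_def sum_nonneg)
  have K: "(\<Sum>h\<in>I. \<bar>z h\<bar>) \<le> K v * norm (\<Sum>h\<in>I. z h *\<^sub>R a h)"
    if sgn: "\<And>h. h \<in> I \<Longrightarrow> sgn (z h) = sgn (a h \<bullet> v)" for v z
  proof -
    let ?N = "norm (\<Sum>h\<in>I. z h *\<^sub>R a h)"
    have prod: "z h * (a h \<bullet> v) = \<bar>z h\<bar> * \<bar>a h \<bullet> v\<bar>" if "h \<in> I" for h
      using sgn[OF that] by (auto simp: sgn_if abs_if split: if_splits)
    have "\<bar>z h\<bar> \<le> norm v / \<bar>a h \<bullet> v\<bar> * ?N" if h: "h \<in> I" for h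
    proof (cases "a h \<bullet> v = 0")
      case True
      then have "z h = 0"
        using sgn[OF h] by (simp add: sgn_0_0)
      then show ?thesis
        using True by simp
    next
      case False
      have "\<bar>z h\<bar> * \<bar>a h \<bullet> v\<bar> \<le> (\<Sum>k\<in>I. \<bar>z k\<bar> * \<bar>a k \<bullet> v\<bar>)"
        using h assms by (intro member_le_sum) auto
      also have "\<dots> = (\<Sum>h\<in>I. z h *\<^sub>R a h) \<bullet> v"
        by (simp add: inner_sum_left prod)
      also have "\<dots> \<le> ?N * norm v"
        by (rule norm_cauchy_schwarz)
      finally show ?thesis
        using False by (simp add: field_simps)
    qed
    then have "(\<Sum>h\<in>I. \<bar>z h\<bar>) \<le> (\<Sum>h\<in>I. norm v / \<bar>a h \<bullet> v\<bar> * ?N)"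
      by (rule sum_mono)
    then show ?thesis
      by (simp add: K_def sum_distrib_right)
  qed
  \<comment> \<open>The summand \<open>1\<close> keeps \<open>C\<close> positive also when every \<open>a h\<close> is zero.\<close>
  define C where "C = 1 + (\<Sum>v\<in>V. K v)"
  have "0 < C"
    using K_nonneg by (simp add: C_def add_pos_nonneg sum_nonneg)
  moreover have "(\<Sum>h\<in>I. \<bar>z h\<bar>) \<le> C * norm (\<Sum>h\<in>I. z h *\<^sub>R a h)"
    if sgn: "\<And>h. h \<in> I \<Longrightarrow> sgn (z h) = sgn (a h \<bullet> v)" for v z
  proof -
    obtain v' where v': "v' \<in> V" "pat v = pat v'"
      using V(2) by (metis imageE rangeI)
    have "sgn (z h) = sgn (a h \<bullet> v')" if "h \<in> I" for h
      using sgn[OF that] fun_cong[OF v'(2), of h] that by (simp add: pat_def)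
    then have "(\<Sum>h\<in>I. \<bar>z h\<bar>) \<le> K v' * norm (\<Sum>h\<in>I. z h *\<^sub>R a h)"
      by (rule K)
    also have "K v' \<le> C"
      unfolding C_def using member_le_sum[OF v'(1), of K] K_nonneg V(1) by auto
    then have "K v' * norm (\<Sum>h\<in>I. z h *\<^sub>R a h) \<le> C * norm (\<Sum>h\<in>I. z h *\<^sub>R a h)"
      by (rule mult_right_mono) simp
    finally show ?thesis .
  qed
  ultimately show thesis
    using that by blast
qed

section \<open>The bi-Lipschitz map\<close>

definition log_map :: "('a::euclidean_space \<times> real) set \<Rightarrow> 'a \<Rightarrow> 'a" where
  "log_map H x = (\<Sum>h\<in>H. ln (slack h x) *\<^sub>R fst h)"

lemma log_map_diff:
  "log_map H x - log_map H y = (\<Sum>h\<in>H. (ln (slack h x) - ln (slack h y)) *\<^sub>R fst h)"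
  by (simp add: log_map_def sum_subtractf scaleR_left_diff_distrib)

lemma continuous_on_log_map:
  assumes "S \<subseteq> cell H"
  shows "continuous_on S (log_map H)"
  unfolding log_map_def using assms
  by (intro continuous_intros) (force simp: cell_def)

lemma log_map_le_log_gap:
  assumes "finite H"
  shows "norm (log_map H x - log_map H y) \<le> (\<Sum>h\<in>H. norm (fst h)) * log_gap H x y"
proof -
  have "norm (log_map H x - log_map H y) \<le> (\<Sum>h\<in>H. log_gap H x y * norm (fst h))"
    unfolding log_map_diff
    using log_gap_member[OF assms] by (intro sum_norm_le) (simp add: mult_right_mono)
  then show ?thesis
    by (simp add: sum_distrib_left mult.commute)
qed

lemma log_gap_le_log_map:
  assumes "finite H"
  obtains C where "0 < C"
    "\<And>x y. x \<in> cell H \<Longrightarrow> y \<in> cell H \<Longrightarrow>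
       log_gap H x y \<le> C * norm (log_map H x - log_map H y)"
proof -
  obtain C where "0 < C" and C:
    "\<And>v z. (\<And>h. h \<in> H \<Longrightarrow> sgn (z h) = sgn (fst h \<bullet> v)) \<Longrightarrow>
       (\<Sum>h\<in>H. \<bar>z h\<bar>) \<le> C * norm (\<Sum>h\<in>H. z h *\<^sub>R fst h)"
    using sign_coherent_sum_bound[OF assms, of fst] by blast
  have "log_gap H x y \<le> C * norm (log_map H x - log_map H y)"
    if xy: "x \<in> cell H" "y \<in> cell H" for x y
    unfolding log_gap_def log_map_diff
  proof (rule C)
    fix h assume "h \<in> H"
    then have "0 < slack h x" "0 < slack h y"
      using xy by (auto simp: cell_def)
    then have "sgn (ln (slack h x) - ln (slack h y)) = sgn (slack h x - slack h y)"
      by (auto simp: sgn_if)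
    also have "slack h x - slack h y = fst h \<bullet> (x - y)"
      by (simp add: slack_def inner_diff_right)
    finally show "sgn (ln (slack h x) - ln (slack h y)) = sgn (fst h \<bullet> (x - y))" .
  qed
  then show thesis
    using that \<open>0 < C\<close> by blast
qed

lemma surj_log_map:
  assumes H: "finite H" and "bounded (cell H)" "cell H \<noteq> {}" and inj: "inj_on (log_map H) (cell H)"
  shows "log_map H ` cell H = UNIV"
proof -
  have "open (log_map H ` cell H)"
    using continuous_on_log_map[OF order_refl] open_cell[OF H] inj by (rule invariance_of_domain)
  moreover have "closed (log_map H ` cell H)"
  proof -
    obtain C where "0 < C" and C: "\<And>x y. x \<in> cell H \<Longrightarrow> y \<in> cell H \<Longrightarrow>
       log_gap H x y \<le> C * norm (log_map H x - log_map H y)"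
      using log_gap_le_log_map[OF H] by blast
    obtain x0 where x0: "x0 \<in> cell H"
      using assms by blast
    have "w \<in> log_map H ` cell H" if w: "w \<in> closure (log_map H ` cell H)" for w
    proof -
      \<comment> \<open>If the image of \<open>x\<close> is within distance \<open>1\<close> of \<open>w\<close>, then \<open>R\<close> bounds \<open>log_gap H x x0\<close>, so no
        slack at \<open>x\<close> is smaller than \<open>exp (- R)\<close> times its value at \<open>x0\<close>.\<close>
      define R where "R = C * (1 + norm (w - log_map H x0))"
      define K where "K = closure (cell H) \<inter> (\<Inter>h\<in>H. {x. slack h x0 * exp (- R) \<le> slack h x})"
      have "closed {x. slack h x0 * exp (- R) \<le> slack h x}" for h
        by (intro closed_Collect_le continuous_intros)
      then have "compact K"
        unfolding K_def using assms(2) by (intro compact_Int_closed) auto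
      have "K \<subseteq> cell H"
      proof
        fix x assume x: "x \<in> K"
        have "0 < slack h x" if "h \<in> H" for h
        proof -
          have "0 < slack h x0 * exp (- R)"
            using that x0 by (simp add: cell_def)
          also have "\<dots> \<le> slack h x"
            using that x by (simp add: K_def)
          finally show ?thesis .
        qed
        then show "x \<in> cell H"
          by (simp add: cell_def)
      qed
      \<comment> \<open>Near \<open>w\<close> the whole image comes from the compact set \<open>K\<close>.\<close>
      have near: "x \<in> K" if x: "x \<in> cell H" "dist (log_map H x) w < 1" for x
      proof -
        have "norm (log_map H x - log_map H x0) \<le> 1 + norm (w - log_map H x0)"
          using norm_triangle_ineq[of "log_map H x - w" "w - log_map H x0"] x(2)
          by (simp add: dist_norm)
        then have "C * norm (log_map H x - log_map H x0) \<le> R"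
          unfolding R_def using \<open>0 < C\<close> by (intro mult_left_mono) auto
        then have gap: "log_gap H x x0 \<le> R"
          using C[OF x(1) x0] by linarith
        have "slack h x0 * exp (- R) \<le> slack h x" if "h \<in> H" for h
        proof -
          have pos: "0 < slack h x" "0 < slack h x0"
            using that x x0 by (auto simp: cell_def)
          have "ln (slack h x0 * exp (- R)) \<le> ln (slack h x)"
            using log_gap_member[OF H that, of x x0] gap pos by (simp add: ln_mult)
          then show ?thesis
            using pos by simp
        qed
        then show ?thesis
          using x(1) closure_subset by (auto simp: K_def)
      qed
      have "w \<in> closure (log_map H ` K)"
        unfolding closure_approachable
      proof (intro allI impI)
        fix e :: real assume "0 < e"
        then obtain x where "x \<in> cell H" "dist (log_map H x) w < min e 1"
          using w unfolding closure_approachable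
          by (metis imageE min_less_iff_conj zero_less_one)
        then show "\<exists>y\<in>log_map H ` K. dist y w < e"
          using near by auto
      qed
      moreover have "compact (log_map H ` K)"
        using continuous_on_log_map[OF \<open>K \<subseteq> cell H\<close>] \<open>compact K\<close>
        by (rule compact_continuous_image)
      ultimately have "w \<in> log_map H ` K"
        by (simp add: compact_imp_closed)
      then show ?thesis
        using \<open>K \<subseteq> cell H\<close> by blast
    qed
    then have "closure (log_map H ` cell H) \<subseteq> log_map H ` cell H"
      by (rule subsetI)
    then show ?thesis
      by (simp only: closure_subset_eq)
  qed
  ultimately show ?thesis
    using assms(3) clopen[of "log_map H ` cell H"] by simp
qed

theorem theorem1:
  fixes P :: "(real ^ 'n) set"
  assumes "open_convex_polytope P"
  shows "\<exists>(F :: real ^ 'n \<Rightarrow> real ^ 'n) L. L > 0 \<and> bij_betw F P UNIV \<and>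
           (\<forall>x\<in>P. \<forall>y\<in>P.
              1 / L * norm (F x - F y) \<le> hilbert_dist P x y \<and>
              hilbert_dist P x y \<le> L * norm (F x - F y))"
proof -
  obtain H where H: "finite H" "P = cell H" "bounded (cell H)" "cell H \<noteq> {}"
    using open_convex_polytope_cell[OF assms] by metis
  obtain C where "0 < C" and C: "\<And>x y. x \<in> P \<Longrightarrow> y \<in> P \<Longrightarrow>
      log_gap H x y \<le> C * norm (log_map H x - log_map H y)"
    using log_gap_le_log_map[OF H(1)] H(2) by blast
  note gap = log_gap_equivalent_hilbert_dist[OF H(1,3), folded H(2)]
  have upper: "hilbert_dist P x y \<le> C * norm (log_map H x - log_map H y)"
    if "x \<in> P" "y \<in> P" for x y
    using gap(1)[OF that] C[OF that] by linarith
  define B where "B = (\<Sum>h\<in>H. norm (fst h)) * (2 * card H)"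
  have "0 \<le> B"
    by (simp add: B_def sum_nonneg)
  have lower: "norm (log_map H x - log_map H y) \<le> B * hilbert_dist P x y"
    if "x \<in> P" "y \<in> P" for x y
  proof -
    have "norm (log_map H x - log_map H y) \<le> (\<Sum>h\<in>H. norm (fst h)) * log_gap H x y"
      by (rule log_map_le_log_gap[OF H(1)])
    also have "\<dots> \<le> (\<Sum>h\<in>H. norm (fst h)) * (2 * card H * hilbert_dist P x y)"
      using gap(2)[OF that] by (intro mult_left_mono) (auto simp: sum_nonneg)
    finally show ?thesis
      by (simp add: B_def mult.assoc)
  qed
  have inj: "inj_on (log_map H) P"
  proof (rule inj_onI, rule ccontr)
    fix x y assume xy: "x \<in> P" "y \<in> P" "log_map H x = log_map H y" "x \<noteq> y"
    then show False
      using gap(3)[OF xy(1,2,4)] upper[OF xy(1,2)] by simp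
  qed
  define L where "L = B + C"
  have "0 < L"
    using \<open>0 < C\<close> \<open>0 \<le> B\<close> by (simp add: L_def)
  have "bij_betw (log_map H) P UNIV"
    unfolding bij_betw_def using inj surj_log_map[OF H(1,3,4)] H(2) by simp
  moreover have "1 / L * norm (log_map H x - log_map H y) \<le> hilbert_dist P x y \<and>
      hilbert_dist P x y \<le> L * norm (log_map H x - log_map H y)" if "x \<in> P" "y \<in> P" for x y
  proof
    have "0 \<le> hilbert_dist P x y"
      using gap(3)[OF that] by (cases "x = y") (auto simp: hilbert_dist_def)
    then have "B * hilbert_dist P x y \<le> L * hilbert_dist P x y"
      using \<open>0 < C\<close> by (simp add: L_def mult_right_mono)
    then have "norm (log_map H x - log_map H y) \<le> L * hilbert_dist P x y"
      using lower[OF that] by linarith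
    then show "1 / L * norm (log_map H x - log_map H y) \<le> hilbert_dist P x y"
      using \<open>0 < L\<close> by (simp add: field_simps)
    have "C * norm (log_map H x - log_map H y) \<le> L * norm (log_map H x - log_map H y)"
      using \<open>0 \<le> B\<close> by (simp add: L_def mult_right_mono)
    then show "hilbert_dist P x y \<le> L * norm (log_map H x - log_map H y)"
      using upper[OF that] by linarith
  qed
  ultimately show ?thesis
    using \<open>0 < L\<close> by blast
qed

end
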